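(* Let $\mathcal G\in V^*$. Suppose that $\mathbb E_{\boldsymbol\Delta}[Q_\ell(\mathcal G(u_\ell-u_{\ell-1}))]=\mathbb E_{\boldsymbol y}[\mathcal G(u_\ell-u_{\ell-1})]$ for all $\ell=0,\dots,L$, and that there exist positive constants $\alpha_{\mathcal G},\alpha',\beta_{\mathcal G},\beta',\eta$ such that M1. $|\mathbb E_{\boldsymbol y}[\mathcal G(u-u_L)]|\lesssim h_L^{\alpha_{\mathcal G}}+s_L^{-\alpha'}$, and M2. $\mathbb V_{\boldsymbol\Delta}[Q_\ell(\mathcal G(u_\ell-u_{\ell-1}))]\lesssim R^{-1}N_\ell^{-\eta}\big(h_{\ell-1}^{\beta_{\mathcal G}}+s_{\ell-1}^{-\beta'}\big)$ for all $\ell=0,1,\dots,L$. Then $$\mathbb E_{\boldsymbol\Delta}\Big[\big|\mathbb E_{\boldsymbol y}[\mathcal G(u)]-\widehat Q^{\mathrm{ML}}_{L,R}(\mathcal G(u))\big|^2\Big]\lesssim h_L^{2\alpha_{\mathcal G}}+s_L^{-2\alpha'}+\frac1R\sum_{\ell=0}^L\frac1{N_\ell^{\eta}}\Big(h_{\ell-1}^{\beta_{\mathcal G}}+s_{\ell-1}^{-\beta'}\Big).$$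
   Context: Let $D\subset\mathbb R^d$, $d\in\{1,2,3\}$, be a bounded convex domain and $\Omega=[-\frac12,\frac12]^{\mathbb N}$ with the product uniform measure; $\mathbb E_{\boldsymbol y}[f]=\int_\Omega f(\boldsymbol y)\,d\boldsymbol y$. Coefficients: $a(\boldsymbol x,\boldsymbol y)=a_0(\boldsymbol x)+\sum_{j\ge1}y_ja_j(\boldsymbol x)$, $b(\boldsymbol x,\boldsymbol y)=b_0(\boldsymbol x)+\sum_{j\ge1}y_jb_j(\boldsymbol x)$, $c=c(\boldsymbol x)$, all in $L^\infty(D)$, with $a\ge a_{\min}>0$, $b\ge0$, $c\ge a_{\min}$ for all $\boldsymbol x,\boldsymbol y$; $\sum_j\max(\|a_j\|_{L^\infty},\|b_j\|_{L^\infty})^p<\infty$ and $\sum_j\|\nabla a_j\|_{L^\infty}^q<\infty$ for some $p,q\in(0,1)$; and $\|a(\boldsymbol y)\|_{L^\infty},\|\nabla a(\boldsymbol y)\|_{L^\infty},\|b(\boldsymbol y)\|_{L^\infty},\|c\|_{L^\infty}\le a_{\max}<\infty$ uniformly in $\boldsymbol y$. Eigenproblem: $V=H^1_0(D)$ with dual $V^*$; $\lambda(\boldsymbol y)$ is the smallest eigenvalue, with eigenfunction $u(\boldsymbol y)\in V$, of $\int_D a\nabla u\cdot\nabla v+\int_D b\,uv=\lambda\int_D c\,uv$ for all $v\in V$, $\int_Dc\,u^2=1$. For $s\in\mathbb N$ and a conforming piecewise linear FE space $V_h\subset V$ of meshwidth $h$, $(\lambda_{h,s}(\boldsymbol y),u_{h,s}(\boldsymbol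 y))$ is the smallest eigenpair (normalised in the same way) of the same problem posed on $V_h$ with $y_j$ set to $0$ for all $j>s$. Signs of eigenfunctions are fixed consistently, so that they depend smoothly on $\boldsymbol y$ and the FE eigenfunctions approximate the exact ones. Levels: $L\in\mathbb N$; meshwidths $h_0>h_1>\dots>h_L>0$, truncation dimensions $s_0\le s_1\le\dots\le s_L$, and by convention $h_{-1}=1$, $s_{-1}=1$; $u_\ell=u_{h_\ell,s_\ell}$ for $\ell\ge0$ and $u_{-1}=0$. Quadrature: an $N$-point randomly shifted lattice rule in $s$ dimensions with generating vector $\boldsymbol z\in\mathbb N^s$ and shift $\boldsymbol\Delta\in[0,1)^s$ is $Q_{s,N}(\boldsymbol\Delta)f=\frac1N\sum_{k=0}^{N-1}f\big(\{k\boldsymbol z/N+\boldsymbol\Delta\}-(\frac12,\dots,\frac12)\big)$, where $\{\cdot\}$ is the componentwise fractional part. For $R\in\mathbb N$, let $\boldsymbol\Delta_\ell^{(r)}$ ($0\le\ell\le L$, $1\le r\le R$) be independent random shifts, uniform on $[0,1)^{s_\ell}$, and set $Q_\ell f:=\frac1R\sum_{r=1}^RQ_{s_\ell,N_\ell}(\boldsymbol\Delta_\ell^{(r)})f$. The multilevel estimator is $\widehat Q^{\mathrm{ML}}_{L,R}(\mathcal G(u))=\sum_{\ell=0}^LQ_\ell(\mathcal G(u_\ell-u_{\ell-1}))$. $\mathbb E_{\boldsymbol\Delta}$ is expectation over all shifts, and $\mathbb V_{\boldsymbol\Delta}[Q_\ell f]:=\mathbb E_{\boldsymbol\Delta}[|\mathbb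 E_{\boldsymbol y}[f]-Q_\ell f|^2]$. $A\lesssim B$ means $A\le CB$ with $C$ independent of $L,R$ and of all $h_\ell,s_\ell,N_\ell$. *)

theory Defs
  imports "HOL-Probability.Probability"
begin

section \<open>Function spaces on a domain\<close>

definition partial :: "'d \<Rightarrow> (real ^ 'd \<Rightarrow> real) \<Rightarrow> real ^ 'd \<Rightarrow> real" where
  "partial i f x = frechet_derivative f (at x) (axis i 1)"

definition grad :: "(real ^ 'd \<Rightarrow> real) \<Rightarrow> real ^ 'd \<Rightarrow> real ^ 'd" where
  "grad f x = (\<chi> i. partial i f x)"

fun Ck :: "nat \<Rightarrow> (real ^ 'd \<Rightarrow> real) \<Rightarrow> bool" where
  "Ck 0 f \<longleftrightarrow> continuous_on UNIV f"
| "Ck (Suc k) f \<longleftrightarrow> (\<forall>x. f differentiable (at x)) \<and> (\<forall>i. Ck k (partial i f))"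

definition test_functions :: "(real ^ 'd) set \<Rightarrow> (real ^ 'd \<Rightarrow> real) set" where
  "test_functions D =
     {\<phi>. (\<forall>k. Ck k \<phi>) \<and> compact (closure {x. \<phi> x \<noteq> 0}) \<and> closure {x. \<phi> x \<noteq> 0} \<subseteq> D}"

definition locally_integrable ::
  "(real ^ 'd) set \<Rightarrow> (real ^ 'd \<Rightarrow> 'b :: {banach, second_countable_topology}) \<Rightarrow> bool" where
  "locally_integrable D f \<longleftrightarrow> (\<forall>K. compact K \<and> K \<subseteq> D \<longrightarrow> integrable (lebesgue_on K) f)"

definition has_weak_grad ::
  "(real ^ 'd) set \<Rightarrow> (real ^ 'd \<Rightarrow> real) \<Rightarrow> (real ^ 'd \<Rightarrow> real ^ 'd) \<Rightarrow> bool" where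
  "has_weak_grad D f g \<longleftrightarrow> locally_integrable D f \<and> locally_integrable D g \<and>
     (\<forall>\<phi>\<in>test_functions D. \<forall>i.
        (LINT x|lebesgue_on D. f x * partial i \<phi> x) = - (LINT x|lebesgue_on D. g x $ i * \<phi> x))"

text \<open>A weak gradient is unique only up to a null set; all uses below are insensitive to the
  choice of the representative.\<close>

definition weak_grad :: "(real ^ 'd) set \<Rightarrow> (real ^ 'd \<Rightarrow> real) \<Rightarrow> real ^ 'd \<Rightarrow> real ^ 'd" where
  "weak_grad D f = (SOME g. has_weak_grad D f g)"

definition in_L2 ::
  "(real ^ 'd) set \<Rightarrow> (real ^ 'd \<Rightarrow> 'b :: {banach, second_countable_topology}) \<Rightarrow> bool" where
  "in_L2 D f \<longleftrightarrow>
     f \<in> borel_measurable (lebesgue_on D) \<and> integrable (lebesgue_on D) (\<lambda>x. (norm (f x))\<^sup>2)"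

definition in_Linf ::
  "(real ^ 'd) set \<Rightarrow> (real ^ 'd \<Rightarrow> 'b :: {banach, second_countable_topology}) \<Rightarrow> bool" where
  "in_Linf D f \<longleftrightarrow>
     f \<in> borel_measurable (lebesgue_on D) \<and> (\<exists>C. AE x in lebesgue_on D. norm (f x) \<le> C)"

definition Linf_norm ::
  "(real ^ 'd) set \<Rightarrow> (real ^ 'd \<Rightarrow> 'b :: {banach, second_countable_topology}) \<Rightarrow> real" where
  "Linf_norm D f = real_of_ereal (esssup (lebesgue_on D) (\<lambda>x. ereal (norm (f x))))"

definition in_W1inf :: "(real ^ 'd) set \<Rightarrow> (real ^ 'd \<Rightarrow> real) \<Rightarrow> bool" where
  "in_W1inf D f \<longleftrightarrow> in_Linf D f \<and> (\<exists>g. has_weak_grad D f g \<and> in_Linf D g)"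

definition H1_norm :: "(real ^ 'd) set \<Rightarrow> (real ^ 'd \<Rightarrow> real) \<Rightarrow> real" where
  "H1_norm D f = sqrt ((LINT x|lebesgue_on D. (f x)\<^sup>2)
                     + (LINT x|lebesgue_on D. (norm (weak_grad D f x))\<^sup>2))"

text \<open>\<open>H\<^sup>1\<^sub>0(D)\<close> is the closure of the test functions in \<open>H\<^sup>1(D)\<close>. Its elements are represented by
  functions rather than by classes modulo null sets.\<close>

definition H10 :: "(real ^ 'd) set \<Rightarrow> (real ^ 'd \<Rightarrow> real) set" where
  "H10 D = {u. in_L2 D u \<and> (\<exists>g. has_weak_grad D u g \<and> in_L2 D g \<and>
     (\<exists>\<phi>. (\<forall>n. \<phi> n \<in> test_functions D) \<and>
        (\<lambda>n. LINT x|lebesgue_on D. (u x - \<phi> n x)\<^sup>2) \<longlonglongrightarrow> 0 \<and>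
        (\<lambda>n. LINT x|lebesgue_on D. (norm (g x - grad (\<phi> n) x))\<^sup>2) \<longlonglongrightarrow> 0))}"

text \<open>The bound in the \<open>H\<^sup>1\<close> norm makes a dual element take equal values on functions that agree
  almost everywhere.\<close>

definition dual_H10 :: "(real ^ 'd) set \<Rightarrow> ((real ^ 'd \<Rightarrow> real) \<Rightarrow> real) set" where
  "dual_H10 D = {G.
     (\<forall>u\<in>H10 D. \<forall>v\<in>H10 D. \<forall>s t. G (\<lambda>x. s * u x + t * v x) = s * G u + t * G v) \<and>
     (\<exists>C. \<forall>u\<in>H10 D. \<bar>G u\<bar> \<le> C * H1_norm D u)}"


section \<open>The parameter space\<close>

text \<open>Parameters are numbered from 0: \<open>y j\<close> is the \<open>(j+1)\<close>-st parameter, and it multiplies the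
  coefficient function \<open>f (Suc j)\<close>, while \<open>f 0\<close> is the mean field.\<close>

definition Params :: "(nat \<Rightarrow> real) set" where
  "Params = {y. \<forall>j. y j \<in> {-1/2..1/2}}"

definition param_measure :: "(nat \<Rightarrow> real) measure" where
  "param_measure = PiM UNIV (\<lambda>_. restrict_space lborel {-1/2..1/2})"

definition E_y :: "((nat \<Rightarrow> real) \<Rightarrow> real) \<Rightarrow> real" where
  "E_y f = (LINT y|param_measure. f y)"

definition affine_coeff ::
  "(nat \<Rightarrow> real ^ 'd \<Rightarrow> real) \<Rightarrow> (nat \<Rightarrow> real) \<Rightarrow> real ^ 'd \<Rightarrow> real" where
  "affine_coeff f y x = f 0 x + (\<Sum>j. y j * f (Suc j) x)"

definition trunc_param :: "nat \<Rightarrow> (nat \<Rightarrow> real) \<Rightarrow> nat \<Rightarrow> real" where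
  "trunc_param s y j = (if j < s then y j else 0)"

text \<open>\<open>C\<^sup>\<infinity>\<close> dependence on the parameter as a map into \<open>H\<^sup>1\<^sub>0(D)\<close>: the mixed partial derivatives
  \<open>dU \<nu>\<close> exist for all finitely supported multi-indices \<open>\<nu>\<close> and are continuous for the product
  topology on the parameter space. Derivatives at the end points of the intervals are one-sided.\<close>

definition smooth_in_param ::
  "(real ^ 'd) set \<Rightarrow> ((nat \<Rightarrow> real) \<Rightarrow> real ^ 'd \<Rightarrow> real) \<Rightarrow> bool" where
  "smooth_in_param D u \<longleftrightarrow>
     (\<exists>dU :: (nat \<Rightarrow> nat) \<Rightarrow> (nat \<Rightarrow> real) \<Rightarrow> real ^ 'd \<Rightarrow> real.
        (\<forall>y\<in>Params. dU (\<lambda>_. 0) y = u y) \<and>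
        (\<forall>\<nu>. finite {j. \<nu> j \<noteq> 0} \<longrightarrow> (\<forall>y\<in>Params.
           dU \<nu> y \<in> H10 D \<and>
           ((\<lambda>y'. H1_norm D (\<lambda>x. dU \<nu> y' x - dU \<nu> y x)) \<longlongrightarrow> 0) (at y within Params) \<and>
           (\<forall>j. ((\<lambda>t. H1_norm D (\<lambda>x. (dU \<nu> (y(j := t)) x - dU \<nu> y x) / (t - y j)
                                        - dU (\<nu>(j := Suc (\<nu> j))) y x)) \<longlongrightarrow> 0)
                  (at (y j) within {-1/2..1/2})))))"


section \<open>The eigenproblem and its finite element discretisation\<close>

definition eigenpair ::
  "(real ^ 'd) set \<Rightarrow> (real ^ 'd \<Rightarrow> real) set \<Rightarrow>
   (real ^ 'd \<Rightarrow> real) \<Rightarrow> (real ^ 'd \<Rightarrow> real) \<Rightarrow> (real ^ 'd \<Rightarrow> real) \<Rightarrow>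
   real \<Rightarrow> (real ^ 'd \<Rightarrow> real) \<Rightarrow> bool" where
  "eigenpair D W a b c l u \<longleftrightarrow> u \<in> W \<and>
     (\<forall>v\<in>W. (LINT x|lebesgue_on D. a x * (weak_grad D u x \<bullet> weak_grad D v x))
            + (LINT x|lebesgue_on D. b x * u x * v x)
            = l * (LINT x|lebesgue_on D. c x * u x * v x)) \<and>
     (LINT x|lebesgue_on D. c x * (u x)\<^sup>2) = 1"

definition smallest_eigenpair ::
  "(real ^ 'd) set \<Rightarrow> (real ^ 'd \<Rightarrow> real) set \<Rightarrow>
   (real ^ 'd \<Rightarrow> real) \<Rightarrow> (real ^ 'd \<Rightarrow> real) \<Rightarrow> (real ^ 'd \<Rightarrow> real) \<Rightarrow>
   real \<Rightarrow> (real ^ 'd \<Rightarrow> real) \<Rightarrow> bool" where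
  "smallest_eigenpair D W a b c l u \<longleftrightarrow>
     eigenpair D W a b c l u \<and> (\<forall>m w. eigenpair D W a b c m w \<longrightarrow> l \<le> m)"

text \<open>The union of the mesh is the closure of \<open>D\<close> if this is a polytope. For other convex domains
  it is an inscribed polyhedron with its boundary vertices on the boundary of \<open>D\<close>, and finite
  element functions are extended by zero.\<close>

definition mesh_of :: "(real ^ 'd) set \<Rightarrow> real \<Rightarrow> (real ^ 'd) set set \<Rightarrow> bool" where
  "mesh_of D h \<T> \<longleftrightarrow> \<T> \<noteq> {} \<and> triangulation \<T> \<and> (\<forall>K\<in>\<T>. int CARD('d) simplex K) \<and>
     \<Union>\<T> \<subseteq> closure D \<and>
     (\<forall>K\<in>\<T>. \<forall>x. x extreme_point_of K \<and> x \<in> frontier (\<Union>\<T>) \<longrightarrow> x \<in> frontier D) \<and>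
     (polytope (closure D) \<longrightarrow> \<Union>\<T> = closure D) \<and>
     Max (diameter ` \<T>) = h"

definition fe_space :: "(real ^ 'd) set \<Rightarrow> real \<Rightarrow> (real ^ 'd \<Rightarrow> real) set \<Rightarrow> bool" where
  "fe_space D h W \<longleftrightarrow> W \<subseteq> H10 D \<and>
     (\<exists>\<T>. mesh_of D h \<T> \<and>
        W = {v. continuous_on UNIV v \<and> (\<forall>x. x \<notin> \<Union>\<T> \<longrightarrow> v x = 0) \<and>
                (\<forall>K\<in>\<T>. \<exists>g k. \<forall>x\<in>K. v x = g \<bullet> x + k)})"


section \<open>The multilevel estimator\<close>

text \<open>\<open>meshwidth\<close>, \<open>trunc_dim\<close>, \<open>num_points\<close> and \<open>gen_vec\<close> take the level as first argument; only
  the levels up to \<open>num_levels\<close> matter, as do only the first \<open>trunc_dim \<kappa> \<ell>\<close> components of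
  \<open>gen_vec \<kappa> \<ell>\<close>.\<close>

record mlqmc_config =
  num_levels :: nat
  num_shifts :: nat
  meshwidth :: "nat \<Rightarrow> real"
  trunc_dim :: "nat \<Rightarrow> nat"
  num_points :: "nat \<Rightarrow> nat"
  gen_vec :: "nat \<Rightarrow> nat \<Rightarrow> nat"

definition admissible :: "real set \<Rightarrow> mlqmc_config \<Rightarrow> bool" where
  "admissible H \<kappa> \<longleftrightarrow>
     1 \<le> num_shifts \<kappa> \<and>
     (\<forall>l\<le>num_levels \<kappa>. meshwidth \<kappa> l \<in> H \<and> 0 < meshwidth \<kappa> l \<and>
        1 \<le> trunc_dim \<kappa> l \<and> 1 \<le> num_points \<kappa> l) \<and>
     (\<forall>l<num_levels \<kappa>. meshwidth \<kappa> (Suc l) < meshwidth \<kappa> l \<and>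
        trunc_dim \<kappa> l \<le> trunc_dim \<kappa> (Suc l))"

text \<open>The values on the level preceding level \<open>l\<close>, with value 1 at level \<open>-1\<close>.\<close>

definition prev_meshwidth :: "mlqmc_config \<Rightarrow> nat \<Rightarrow> real" where
  "prev_meshwidth \<kappa> l = (case l of 0 \<Rightarrow> 1 | Suc k \<Rightarrow> meshwidth \<kappa> k)"

definition prev_trunc_dim :: "mlqmc_config \<Rightarrow> nat \<Rightarrow> nat" where
  "prev_trunc_dim \<kappa> l = (case l of 0 \<Rightarrow> 1 | Suc k \<Rightarrow> trunc_dim \<kappa> k)"

text \<open>Below, \<open>U h s y\<close> is the finite element eigenfunction for meshwidth \<open>h\<close> and truncation
  dimension \<open>s\<close>.\<close>

definition level_fun ::
  "(real \<Rightarrow> nat \<Rightarrow> (nat \<Rightarrow> real) \<Rightarrow> real ^ 'd \<Rightarrow> real) \<Rightarrow> mlqmc_config \<Rightarrow> nat \<Rightarrow>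
   (nat \<Rightarrow> real) \<Rightarrow> real ^ 'd \<Rightarrow> real" where
  "level_fun U \<kappa> l = U (meshwidth \<kappa> l) (trunc_dim \<kappa> l)"

definition level_diff ::
  "(real \<Rightarrow> nat \<Rightarrow> (nat \<Rightarrow> real) \<Rightarrow> real ^ 'd \<Rightarrow> real) \<Rightarrow> mlqmc_config \<Rightarrow> nat \<Rightarrow>
   (nat \<Rightarrow> real) \<Rightarrow> real ^ 'd \<Rightarrow> real" where
  "level_diff U \<kappa> l y x =
     level_fun U \<kappa> l y x - (case l of 0 \<Rightarrow> 0 | Suc k \<Rightarrow> level_fun U \<kappa> k y x)"

text \<open>The integrand is a function of the whole parameter sequence; the \<open>s\<close>-dimensional quadrature
  points are extended by zero.\<close>

definition lattice_rule ::
  "nat \<Rightarrow> nat \<Rightarrow> (nat \<Rightarrow> nat) \<Rightarrow> (nat \<Rightarrow> real) \<Rightarrow> ((nat \<Rightarrow> real) \<Rightarrow> real) \<Rightarrow> real" where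
  "lattice_rule s N z \<Delta> f =
     (\<Sum>k<N. f (\<lambda>j. if j < s then frac (real k * real (z j) / real N + \<Delta> j) - 1/2 else 0)) / real N"

text \<open>The canonical probability space of the shifts \<open>\<Delta> (l, r)\<close>, which are independent and uniform
  on the unit cube of dimension \<open>trunc_dim \<kappa> l\<close>.\<close>

definition shift_measure :: "mlqmc_config \<Rightarrow> (nat \<times> nat \<Rightarrow> nat \<Rightarrow> real) measure" where
  "shift_measure \<kappa> = PiM ({..num_levels \<kappa>} \<times> {1..num_shifts \<kappa>})
     (\<lambda>(l, r). PiM {..<trunc_dim \<kappa> l} (\<lambda>_. restrict_space lborel {0..<1}))"

definition E_shift :: "mlqmc_config \<Rightarrow> ((nat \<times> nat \<Rightarrow> nat \<Rightarrow> real) \<Rightarrow> real) \<Rightarrow> real" where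
  "E_shift \<kappa> X = (LINT \<Delta>|shift_measure \<kappa>. X \<Delta>)"

definition Q_level ::
  "mlqmc_config \<Rightarrow> nat \<Rightarrow> ((nat \<Rightarrow> real) \<Rightarrow> real) \<Rightarrow> (nat \<times> nat \<Rightarrow> nat \<Rightarrow> real) \<Rightarrow> real" where
  "Q_level \<kappa> l f \<Delta> =
     (\<Sum>r=1..num_shifts \<kappa>. lattice_rule (trunc_dim \<kappa> l) (num_points \<kappa> l) (gen_vec \<kappa> l) (\<Delta> (l, r)) f)
       / real (num_shifts \<kappa>)"

definition V_shift :: "mlqmc_config \<Rightarrow> nat \<Rightarrow> ((nat \<Rightarrow> real) \<Rightarrow> real) \<Rightarrow> real" where
  "V_shift \<kappa> l f = E_shift \<kappa> (\<lambda>\<Delta>. \<bar>E_y f - Q_level \<kappa> l f \<Delta>\<bar>\<^sup>2)"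

definition Q_ML ::
  "((real ^ 'd \<Rightarrow> real) \<Rightarrow> real) \<Rightarrow>
   (real \<Rightarrow> nat \<Rightarrow> (nat \<Rightarrow> real) \<Rightarrow> real ^ 'd \<Rightarrow> real) \<Rightarrow> mlqmc_config \<Rightarrow>
   (nat \<times> nat \<Rightarrow> nat \<Rightarrow> real) \<Rightarrow> real" where
  "Q_ML G U \<kappa> \<Delta> = (\<Sum>l\<le>num_levels \<kappa>. Q_level \<kappa> l (\<lambda>y. G (level_diff U \<kappa> l y)) \<Delta>)"

text \<open>Estimates up to a constant that is uniform over an index set.\<close>

definition lesssim :: "'i set \<Rightarrow> ('i \<Rightarrow> real) \<Rightarrow> ('i \<Rightarrow> real) \<Rightarrow> bool" where
  "lesssim I A B \<longleftrightarrow> (\<exists>C>0. \<forall>i\<in>I. A i \<le> C * B i)"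

end

theory Submission
  imports Defs
begin

text \<open>Along a smooth family of functions, a functional in the dual of \<open>H\<^sup>1\<^sub>0(D)\<close> is a continuous
  function on the compact parameter space. Hence all integrands are bounded and measurable, the
  quadrature errors of different levels are independent under the random shifts, and, being
  centred, they are orthogonal in \<open>L\<^sup>2\<close>. The expectations of the level differences telescope, so
  the mean square error splits exactly into the squared bias, which M1 bounds, and the sum of the
  variances of the levels, which M2 bounds.\<close>

section \<open>The space \<open>H\<^sup>1\<^sub>0(D)\<close> is closed under subtraction\<close>

text \<open>The bound of \<open>G\<close> holds only on \<open>H10 D\<close>, so comparing
  \<open>G (u y')\<close> with \<open>G (u y)\<close> requires the difference of the two functions
  to lie in that space. Its elements are functions rather than classes, and \<open>weak_grad\<close>
  is a Hilbert choice; closure under subtraction is therefore proved through the witnesses that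
  membership supplies, a weak gradient in L2 and an approximating sequence of test functions, both
  subtracted termwise.

  Integrability is the second obstacle. The integral of a non-integrable function is 0 by
  convention, so an expectation may be split only after its terms are known to be integrable. Every
  shifted lattice point lies in the parameter box, hence one bound on that box serves
  \<open>E_y\<close> and the random shifts alike.

  Expectations of products are factorised only across levels. Products within one level stay inside
  \<open>V_shift\<close>, and the factor \<open>1 / num_shifts\<close> is inherited from M2. The
  only loss in the constants is a factor 2 from squaring the two-term bound in M1.\<close>

lemma partial_diff:
  assumes "f differentiable (at x)" "g differentiable (at x)"
  shows "partial i (\<lambda>x. f x - g x) x = partial i f x - partial i g x"
proof -
  have "((\<lambda>x. f x - g x) has_derivative
      (\<lambda>v. frechet_derivative f (at x) v - frechet_derivative g (at x) v)) (at x)"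
    using assms by (intro has_derivative_diff) (simp_all add: frechet_derivative_works)
  from frechet_derivative_at[OF this] show ?thesis
    unfolding partial_def by metis
qed

lemma Ck_diff: "Ck k f \<Longrightarrow> Ck k g \<Longrightarrow> Ck k (\<lambda>x. f x - g x)"
proof (induction k arbitrary: f g)
  case 0
  then show ?case by (simp add: continuous_on_diff)
next
  case (Suc k)
  then have d: "f differentiable (at x)" "g differentiable (at x)" for x by auto
  have "partial i (\<lambda>x. f x - g x) = (\<lambda>x. partial i f x - partial i g x)" for i
    using partial_diff[OF d] by blast
  with Suc d show ?case by auto
qed

lemma test_functions_Ck: "\<phi> \<in> test_functions D \<Longrightarrow> Ck k \<phi>"
  by (simp add: test_functions_def)

lemma test_functions_differentiable: "\<phi> \<in> test_functions D \<Longrightarrow> \<phi> differentiable (at x)"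
  using test_functions_Ck[of \<phi> D "Suc 0"] by simp

lemma test_functions_continuous: "\<phi> \<in> test_functions D \<Longrightarrow> continuous_on UNIV \<phi>"
  using test_functions_Ck[of \<phi> D 0] by simp

lemma test_functions_continuous_partial:
  "\<phi> \<in> test_functions D \<Longrightarrow> continuous_on UNIV (partial i \<phi>)"
  using test_functions_Ck[of \<phi> D "Suc 0"] by simp

lemma test_functions_diff:
  assumes "\<phi> \<in> test_functions D" "\<psi> \<in> test_functions D"
  shows "(\<lambda>x. \<phi> x - \<psi> x) \<in> test_functions D"
proof -
  have "{x. \<phi> x - \<psi> x \<noteq> 0} \<subseteq> {x. \<phi> x \<noteq> 0} \<union> {x. \<psi> x \<noteq> 0}" by auto
  from closure_mono[OF this] have s: "closure {x. \<phi> x - \<psi> x \<noteq> 0} \<subseteq> closure {x. \<phi> x \<noteq> 0} \<union> closure {x. \<psi> x \<noteq> 0}"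
    by (simp add: closure_Un)
  have "compact (closure {x. \<phi> x \<noteq> 0} \<union> closure {x. \<psi> x \<noteq> 0})"
    using assms by (auto simp: test_functions_def intro: compact_Un)
  from compact_Int_closed[OF this closed_closure[of "{x. \<phi> x - \<psi> x \<noteq> 0}"]]
  have "compact (closure {x. \<phi> x - \<psi> x \<noteq> 0})"
    unfolding Int_absorb1[OF s] .
  moreover have "closure {x. \<phi> x - \<psi> x \<noteq> 0} \<subseteq> D"
    using s assms unfolding test_functions_def by blast
  ultimately show ?thesis
    using assms Ck_diff unfolding test_functions_def by blast
qed

text \<open>Off its closed support the function vanishes on a whole neighbourhood, so its derivative
  there is that of the zero function. Thus the compact support of a test function also serves its
  partial derivatives.\<close>

lemma partial_eq_0_outside:
  assumes "x \<notin> closure {x. f x \<noteq> 0}"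
  shows "partial i f x = 0"
proof -
  have "(f has_derivative (\<lambda>_. 0)) (at x)"
  proof (rule has_derivative_transform_within_open)
    show "open (- closure {x. f x \<noteq> 0})" "x \<in> - closure {x. f x \<noteq> 0}"
      using assms by auto
    show "0 = f y" if "y \<in> - closure {x. f x \<noteq> 0}" for y
      using that closure_subset[of "{x. f x \<noteq> 0}"] by auto
  qed simp
  from frechet_derivative_at[OF this] show ?thesis
    unfolding partial_def by metis
qed

text \<open>Vector values are allowed so that test functions, their partial derivatives and their
  gradients are all covered. Integrability is obtained on the whole space, where a compact set
  carries the function, and then restricted to \<open>D\<close>.\<close>

lemma in_L2_compact_support:
  fixes f :: "real ^ 'd \<Rightarrow> 'b :: {banach, second_countable_topology}"
  assumes D: "D \<in> sets lebesgue" and f: "continuous_on UNIV f"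
    and K: "compact K" "\<And>x. x \<notin> K \<Longrightarrow> f x = 0"
  shows "in_L2 D f"
proof -
  have meas: "f \<in> borel_measurable lebesgue"
    using f by (intro measurable_completion) (simp add: borel_measurable_continuous_onI)
  have "integrable lborel (\<lambda>x. indicator K x *\<^sub>R (norm (f x))\<^sup>2)"
    by (intro borel_integrable_compact K continuous_intros continuous_on_subset[OF f]) auto
  also have "(\<lambda>x. indicator K x *\<^sub>R (norm (f x))\<^sup>2) = (\<lambda>x. (norm (f x))\<^sup>2)"
    using K(2) by (auto simp: indicator_def fun_eq_iff)
  finally have "integrable lebesgue (\<lambda>x. (norm (f x))\<^sup>2)"
    by (simp add: integrable_completion)
  then have "integrable lebesgue (\<lambda>x. indicator D x *\<^sub>R (norm (f x))\<^sup>2)"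
    by (rule integrable_mult_indicator[OF D])
  then show ?thesis
    unfolding in_L2_def using meas D
    by (auto simp: integrable_restrict_space measurable_restrict_space1)
qed

lemma in_L2_test_function:
  assumes "D \<in> sets lebesgue" "\<phi> \<in> test_functions D"
  shows "in_L2 D \<phi>"
proof (rule in_L2_compact_support[OF assms(1) test_functions_continuous[OF assms(2)]])
  show "compact (closure {x. \<phi> x \<noteq> 0})"
    using assms(2) by (simp add: test_functions_def)
  show "\<phi> x = 0" if "x \<notin> closure {x. \<phi> x \<noteq> 0}" for x
    using that closure_subset[of "{x. \<phi> x \<noteq> 0}"] by auto
qed

lemma in_L2_partial_test_function:
  assumes "D \<in> sets lebesgue" "\<phi> \<in> test_functions D"
  shows "in_L2 D (partial i \<phi>)"
  by (rule in_L2_compact_support[OF assms(1) test_functions_continuous_partial[OF assms(2)]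
        _ partial_eq_0_outside])
    (use assms(2) in \<open>simp_all add: test_functions_def\<close>)

lemma in_L2_grad_test_function:
  assumes "D \<in> sets lebesgue" "\<phi> \<in> test_functions D"
  shows "in_L2 D (grad \<phi>)"
proof (rule in_L2_compact_support[OF assms(1)])
  show "continuous_on UNIV (grad \<phi>)"
    unfolding grad_def using test_functions_continuous_partial[OF assms(2)]
    by (intro continuous_on_vec_lambda)
  show "compact (closure {x. \<phi> x \<noteq> 0})"
    using assms(2) by (simp add: test_functions_def)
  show "grad \<phi> x = 0" if "x \<notin> closure {x. \<phi> x \<noteq> 0}" for x
    using partial_eq_0_outside[OF that] by (simp add: grad_def vec_eq_iff)
qed

text \<open>A substitute for Minkowski's inequality: it works with squared norms directly, in the
  form in which \<open>in_L2\<close> and \<open>H10\<close> are stated.\<close>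

lemma norm_diff_sq_le:
  fixes a b :: "'b :: real_normed_vector"
  shows "(norm (a - b))\<^sup>2 \<le> 2 * (norm a)\<^sup>2 + 2 * (norm b)\<^sup>2"
proof -
  have "(norm (a - b))\<^sup>2 \<le> (norm a + norm b)\<^sup>2"
    by (intro power_mono norm_triangle_ineq4) simp
  also have "\<dots> \<le> 2 * (norm a)\<^sup>2 + 2 * (norm b)\<^sup>2"
    using sum_squares_bound[of "norm a" "norm b"] by (simp add: power2_sum)
  finally show ?thesis .
qed

lemma in_L2_diff:
  assumes "in_L2 D f" "in_L2 D g"
  shows "in_L2 D (\<lambda>x. f x - g x)"
proof -
  have m: "f \<in> borel_measurable (lebesgue_on D)" "g \<in> borel_measurable (lebesgue_on D)"
    using assms by (auto simp: in_L2_def)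
  have "integrable (lebesgue_on D) (\<lambda>x. (norm (f x - g x))\<^sup>2)"
    by (rule Bochner_Integration.integrable_bound
        [where f = "\<lambda>x. 2 * (norm (f x))\<^sup>2 + 2 * (norm (g x))\<^sup>2"])
      (use assms m norm_diff_sq_le in \<open>auto simp: in_L2_def\<close>)
  with m show ?thesis by (simp add: in_L2_def)
qed

lemma in_L2_nth:
  assumes "in_L2 D (f :: real ^ 'd \<Rightarrow> real ^ 'd)"
  shows "in_L2 D (\<lambda>x. f x $ i)"
proof -
  have m: "(\<lambda>x. f x $ i) \<in> borel_measurable (lebesgue_on D)"
    using assms unfolding in_L2_def
    by (auto intro!: borel_measurable_continuous_on[where f = "\<lambda>v. v $ i"]
        continuous_on_component continuous_on_id)
  have "integrable (lebesgue_on D) (\<lambda>x. (norm (f x $ i))\<^sup>2)"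
    by (rule Bochner_Integration.integrable_bound[where f = "\<lambda>x. (norm (f x))\<^sup>2"])
      (use assms m component_le_norm_cart in \<open>auto simp: in_L2_def simp flip: abs_le_square_iff\<close>)
  with m show ?thesis by (simp add: in_L2_def)
qed

lemma in_L2_mult_integrable:
  fixes f g :: "real ^ 'd \<Rightarrow> real"
  assumes "in_L2 D f" "in_L2 D g"
  shows "integrable (lebesgue_on D) (\<lambda>x. f x * g x)"
proof (rule Bochner_Integration.integrable_bound[where f = "\<lambda>x. (f x)\<^sup>2 + (g x)\<^sup>2"])
  have "\<bar>f x * g x\<bar> \<le> (f x)\<^sup>2 + (g x)\<^sup>2" for x
    using sum_squares_bound[of "\<bar>f x\<bar>" "\<bar>g x\<bar>"] mult_nonneg_nonneg[of "\<bar>f x\<bar>" "\<bar>g x\<bar>"]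
    unfolding power2_abs abs_mult by linarith
  then show "AE x in lebesgue_on D. norm (f x * g x) \<le> norm ((f x)\<^sup>2 + (g x)\<^sup>2)"
    by auto
qed (use assms in \<open>auto simp: in_L2_def\<close>)

text \<open>The defining identity is linear, but its integrals may be split only if each product
  with a test function or its derivative is integrable. This is what the four L2 assumptions
  provide.\<close>

lemma has_weak_grad_diff:
  fixes D :: "(real ^ 'd) set"
  assumes D: "D \<in> sets lebesgue"
    and L2: "in_L2 D u" "in_L2 D v" "in_L2 D g" "in_L2 D k"
    and wg: "has_weak_grad D u g" "has_weak_grad D v k"
  shows "has_weak_grad D (\<lambda>x. u x - v x) (\<lambda>x. g x - k x)"
  unfolding has_weak_grad_def
proof (intro conjI ballI allI)
  fix \<phi> :: "real ^ 'd \<Rightarrow> real" and i assume \<phi>: "\<phi> \<in> test_functions D"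
  note int = in_L2_mult_integrable[OF _ in_L2_partial_test_function[OF D \<phi>]]
    in_L2_mult_integrable[OF in_L2_nth in_L2_test_function[OF D \<phi>]]
  show "(LINT x|lebesgue_on D. (u x - v x) * partial i \<phi> x)
      = - (LINT x|lebesgue_on D. (g x - k x) $ i * \<phi> x)"
    using wg \<phi> L2 by (simp add: left_diff_distrib int has_weak_grad_def)
next
  have "locally_integrable D u" "locally_integrable D v" "locally_integrable D g" "locally_integrable D k"
    using wg by (simp_all add: has_weak_grad_def)
  then show "locally_integrable D (\<lambda>x. u x - v x)" "locally_integrable D (\<lambda>x. g x - k x)"
    by (simp_all add: locally_integrable_def)
qed

lemma L2_tendsto_diff:
  assumes L2: "in_L2 D u" "in_L2 D v" "\<And>n. in_L2 D (\<phi> n)" "\<And>n. in_L2 D (\<psi> n)"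
    and lim: "(\<lambda>n. LINT x|lebesgue_on D. (norm (u x - \<phi> n x))\<^sup>2) \<longlonglongrightarrow> 0"
      "(\<lambda>n. LINT x|lebesgue_on D. (norm (v x - \<psi> n x))\<^sup>2) \<longlonglongrightarrow> 0"
  shows "(\<lambda>n. LINT x|lebesgue_on D. (norm ((u x - v x) - (\<phi> n x - \<psi> n x)))\<^sup>2) \<longlonglongrightarrow> 0"
\<comment> \<open>The lower barrier is the constant 0; the upper one is twice the sum of the two
  given squared errors.\<close>
proof (rule tendsto_sandwich[OF _ _ tendsto_const])
  let ?b = "\<lambda>n. 2 * (LINT x|lebesgue_on D. (norm (u x - \<phi> n x))\<^sup>2)
    + 2 * (LINT x|lebesgue_on D. (norm (v x - \<psi> n x))\<^sup>2)"
  show "?b \<longlonglongrightarrow> 0"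
    using tendsto_add[OF tendsto_mult_left[OF lim(1), of 2] tendsto_mult_left[OF lim(2), of 2]]
    by simp
  have "(LINT x|lebesgue_on D. (norm ((u x - v x) - (\<phi> n x - \<psi> n x)))\<^sup>2) \<le> ?b n" for n
  proof -
    have i: "integrable (lebesgue_on D) (\<lambda>x. (norm (u x - \<phi> n x))\<^sup>2)"
      "integrable (lebesgue_on D) (\<lambda>x. (norm (v x - \<psi> n x))\<^sup>2)"
      "integrable (lebesgue_on D) (\<lambda>x. (norm ((u x - v x) - (\<phi> n x - \<psi> n x)))\<^sup>2)"
      using in_L2_diff[OF L2(1) L2(3)] in_L2_diff[OF L2(2) L2(4)]
        in_L2_diff[OF in_L2_diff[OF L2(1) L2(2)] in_L2_diff[OF L2(3) L2(4)]]
      by (simp_all add: in_L2_def)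
    have "(LINT x|lebesgue_on D. (norm ((u x - v x) - (\<phi> n x - \<psi> n x)))\<^sup>2)
      \<le> (LINT x|lebesgue_on D. 2 * (norm (u x - \<phi> n x))\<^sup>2 + 2 * (norm (v x - \<psi> n x))\<^sup>2)"
    proof (intro integral_mono i Bochner_Integration.integrable_add integrable_mult_right)
      fix x show "(norm ((u x - v x) - (\<phi> n x - \<psi> n x)))\<^sup>2
          \<le> 2 * (norm (u x - \<phi> n x))\<^sup>2 + 2 * (norm (v x - \<psi> n x))\<^sup>2"
        using norm_diff_sq_le[of "u x - \<phi> n x" "v x - \<psi> n x"] by (simp add: algebra_simps)
    qed
    also have "\<dots> = ?b n" using i by simp
    finally show ?thesis .
  qed
  then show "\<forall>\<^sub>F n in sequentially.
      (LINT x|lebesgue_on D. (norm ((u x - v x) - (\<phi> n x - \<psi> n x)))\<^sup>2) \<le> ?b n"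
    by simp
qed simp

text \<open>The weak gradients \<open>g\<close> and \<open>k\<close> are those stored in the two
  memberships, not the values of \<open>weak_grad\<close>, so no uniqueness of weak gradients
  enters.\<close>

lemma H10_diff:
  assumes D: "D \<in> sets lebesgue" and u: "u \<in> H10 D" and v: "v \<in> H10 D"
  shows "(\<lambda>x. u x - v x) \<in> H10 D"
proof -
  obtain g \<phi> where g: "in_L2 D u" "has_weak_grad D u g" "in_L2 D g"
    "\<And>n. \<phi> n \<in> test_functions D"
    "(\<lambda>n. LINT x|lebesgue_on D. (u x - \<phi> n x)\<^sup>2) \<longlonglongrightarrow> 0"
    "(\<lambda>n. LINT x|lebesgue_on D. (norm (g x - grad (\<phi> n) x))\<^sup>2) \<longlonglongrightarrow> 0"
    using u unfolding H10_def by blast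
  obtain k \<psi> where k: "in_L2 D v" "has_weak_grad D v k" "in_L2 D k"
    "\<And>n. \<psi> n \<in> test_functions D"
    "(\<lambda>n. LINT x|lebesgue_on D. (v x - \<psi> n x)\<^sup>2) \<longlonglongrightarrow> 0"
    "(\<lambda>n. LINT x|lebesgue_on D. (norm (k x - grad (\<psi> n) x))\<^sup>2) \<longlonglongrightarrow> 0"
    using v unfolding H10_def by blast
  \<comment> \<open>Test functions are differentiable everywhere; this is what makes the operator
    \<open>grad\<close>, built on \<open>frechet_derivative\<close>, respect their
    differences.\<close>
  have grad: "grad (\<lambda>x. \<phi> n x - \<psi> n x) x = grad (\<phi> n) x - grad (\<psi> n) x" for n x
    using partial_diff[OF test_functions_differentiable[OF g(4)] test_functions_differentiable[OF k(4)]]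
    by (simp add: grad_def vec_eq_iff)
  show ?thesis
    unfolding H10_def
  proof (intro CollectI conjI exI[of _ "\<lambda>x. g x - k x"] exI[of _ "\<lambda>n x. \<phi> n x - \<psi> n x"] allI)
    show "(\<lambda>n. LINT x|lebesgue_on D. ((u x - v x) - (\<phi> n x - \<psi> n x))\<^sup>2) \<longlonglongrightarrow> 0"
      using L2_tendsto_diff[OF g(1) k(1), of \<phi> \<psi>] in_L2_test_function[OF D] g k by simp
    show "(\<lambda>n. LINT x|lebesgue_on D. (norm ((g x - k x) - grad (\<lambda>x. \<phi> n x - \<psi> n x) x))\<^sup>2) \<longlonglongrightarrow> 0"
      unfolding grad
      using L2_tendsto_diff[OF g(3) k(3), of "\<lambda>n. grad (\<phi> n)" "\<lambda>n. grad (\<psi> n)"]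
        in_L2_grad_test_function[OF D] g k by simp
    show "in_L2 D (\<lambda>x. u x - v x)" "in_L2 D (\<lambda>x. g x - k x)"
      using g k by (simp_all add: in_L2_diff)
    show "has_weak_grad D (\<lambda>x. u x - v x) (\<lambda>x. g x - k x)"
      by (rule has_weak_grad_diff[OF D g(1) k(1) g(3) k(3) g(2) k(2)])
    show "(\<lambda>x. \<phi> n x - \<psi> n x) \<in> test_functions D" for n
      by (rule test_functions_diff[OF g(4) k(4)])
  qed
qed

section \<open>Functionals of smooth families\<close>

lemma dual_H10_diff:
  assumes "G \<in> dual_H10 D" "u \<in> H10 D" "v \<in> H10 D"
  shows "G (\<lambda>x. u x - v x) = G u - G v"
proof -
  have "G (\<lambda>x. 1 * u x + (- 1) * v x) = 1 * G u + (- 1) * G v"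
    using assms unfolding dual_H10_def by blast
  then show ?thesis by simp
qed

lemma smooth_in_param_H10:
  assumes "smooth_in_param D u" "y \<in> Params"
  shows "u y \<in> H10 D"
proof -
  obtain dU :: "(nat \<Rightarrow> nat) \<Rightarrow> (nat \<Rightarrow> real) \<Rightarrow> real ^ 'a \<Rightarrow> real"
    where dU: "\<forall>y\<in>Params. dU (\<lambda>_. 0) y = u y"
      "\<And>\<nu> y. finite {j. \<nu> j \<noteq> 0} \<Longrightarrow> y \<in> Params \<Longrightarrow> dU \<nu> y \<in> H10 D"
    using assms(1) unfolding smooth_in_param_def by blast
  show ?thesis using dU(2)[of "\<lambda>_. 0" y] dU(1) assms(2) by simp
qed

lemma smooth_in_param_tendsto:
  assumes "smooth_in_param D u" "y \<in> Params"
  shows "((\<lambda>y'. H1_norm D (\<lambda>x. u y' x - u y x)) \<longlongrightarrow> 0) (at y within Params)"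
proof -
  obtain dU :: "(nat \<Rightarrow> nat) \<Rightarrow> (nat \<Rightarrow> real) \<Rightarrow> real ^ 'a \<Rightarrow> real"
    where dU: "\<forall>y\<in>Params. dU (\<lambda>_. 0) y = u y"
      "\<And>\<nu> y. finite {j. \<nu> j \<noteq> 0} \<Longrightarrow> y \<in> Params \<Longrightarrow>
        ((\<lambda>y'. H1_norm D (\<lambda>x. dU \<nu> y' x - dU \<nu> y x)) \<longlongrightarrow> 0) (at y within Params)"
    using assms(1) unfolding smooth_in_param_def by blast
  have "((\<lambda>y'. H1_norm D (\<lambda>x. dU (\<lambda>_. 0) y' x - dU (\<lambda>_. 0) y x)) \<longlongrightarrow> 0) (at y within Params)"
    using dU(2)[of "\<lambda>_. 0" y] assms(2) by simp
  \<comment> \<open>The order-zero derivative agrees with \<open>u\<close> on \<open>Params\<close>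
    only, which suffices for a limit within \<open>Params\<close>.\<close>
  then show ?thesis
    by (rule Lim_transform_eventually)
      (use dU(1) assms(2) in \<open>auto simp: eventually_at_filter\<close>)
qed

text \<open>By linearity the increment of \<open>G (u y)\<close> is \<open>G\<close> of the
  increment of \<open>u\<close>, which lies in \<open>H10 D\<close> and is therefore controlled by
  its H1 norm.\<close>

lemma continuous_on_functional:
  assumes D: "D \<in> sets lebesgue" and G: "G \<in> dual_H10 D" and u: "smooth_in_param D u"
  shows "continuous_on Params (\<lambda>y. G (u y))"
  unfolding continuous_on_def
proof
  fix y assume y: "y \<in> Params"
  note H10 = smooth_in_param_H10[OF u]
  obtain C where C: "\<And>v. v \<in> H10 D \<Longrightarrow> \<bar>G v\<bar> \<le> C * H1_norm D v"
    using G unfolding dual_H10_def by blast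
  have lim: "((\<lambda>y'. C * H1_norm D (\<lambda>x. u y' x - u y x)) \<longlongrightarrow> 0) (at y within Params)"
    using tendsto_mult_left[OF smooth_in_param_tendsto[OF u y], of C] by simp
  have "\<bar>G (u y') - G (u y)\<bar> \<le> C * H1_norm D (\<lambda>x. u y' x - u y x)" if "y' \<in> Params" for y'
    using C[OF H10_diff[OF D H10[OF that] H10[OF y]]] dual_H10_diff[OF G H10[OF that] H10[OF y]]
    by simp
  then have "\<forall>\<^sub>F y' in at y within Params.
      norm (G (u y') - G (u y)) \<le> C * H1_norm D (\<lambda>x. u y' x - u y x)"
    by (intro eventually_at_filter[THEN iffD2] always_eventually) simp
  then have "((\<lambda>y'. G (u y') - G (u y)) \<longlongrightarrow> 0) (at y within Params)"
    by (rule Lim_null_comparison[OF _ lim])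
  then show "((\<lambda>y'. G (u y')) \<longlongrightarrow> G (u y)) (at y within Params)"
    by (rule Lim_null[THEN iffD2])
qed

section \<open>Continuous functions on the compact parameter box\<close>

text \<open>Tychonoff's theorem: the topology of the type \<open>nat \<Rightarrow> real\<close> is
  the product topology.\<close>

lemma compact_Params: "compact Params"
proof -
  have "compactin (product_topology (\<lambda>_::nat. euclidean) UNIV) (Pi\<^sub>E UNIV (\<lambda>_. {-1/2..1/2::real}))"
    unfolding compactin_PiE by (simp add: compact_Icc)
  moreover have "Params = Pi\<^sub>E UNIV (\<lambda>_. {-1/2..1/2::real})"
    by (auto simp: Params_def PiE_def Pi_def)
  ultimately show ?thesis
    by (simp add: euclidean_product_topology)
qed

lemma continuous_on_Params_bounded:
  fixes f :: "(nat \<Rightarrow> real) \<Rightarrow> real"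
  assumes "continuous_on Params f"
  shows "\<exists>B. \<forall>y\<in>Params. \<bar>f y\<bar> \<le> B"
  using compact_imp_bounded[OF compact_continuous_image[OF assms compact_Params]]
  unfolding bounded_iff real_norm_def by blast

text \<open>Continuity is known on \<open>Params\<close> only, so \<open>f\<close> is measurable for
  the restricted Borel space and \<open>X\<close> must map into it. With \<open>X\<close> the
  identity this treats the parameter itself, with \<open>X\<close> a lattice point the
  quadrature.\<close>

lemma borel_measurable_into_Params:
  fixes X :: "'a \<Rightarrow> nat \<Rightarrow> real"
  assumes f: "continuous_on Params f"
    and X: "\<And>j. (\<lambda>\<omega>. X \<omega> j) \<in> borel_measurable M" "\<And>\<omega>. \<omega> \<in> space M \<Longrightarrow> X \<omega> \<in> Params"
  shows "(\<lambda>\<omega>. f (X \<omega>)) \<in> borel_measurable M"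
proof (rule measurable_compose[OF _ borel_measurable_continuous_on_restrict[OF f]])
  show "X \<in> M \<rightarrow>\<^sub>M restrict_space borel Params"
    by (rule measurable_restrict_space2) (use X measurable_coordinatewise_then_product in auto)
qed

lemma prob_space_param_measure: "prob_space param_measure"
  unfolding param_measure_def
  by (intro prob_space_PiM prob_space_restrict_space) auto

lemma space_param_measure: "space param_measure = Params"
  by (auto simp: param_measure_def space_PiM space_restrict_space Params_def PiE_def Pi_def)

lemma integrable_param_measure:
  fixes f :: "(nat \<Rightarrow> real) \<Rightarrow> real"
  assumes f: "continuous_on Params f"
  shows "integrable param_measure f"
proof -
  interpret prob_space param_measure by (rule prob_space_param_measure)
  obtain B where "\<And>y. y \<in> Params \<Longrightarrow> \<bar>f y\<bar> \<le> B"
    using continuous_on_Params_bounded[OF f] by blast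
  moreover have "(\<lambda>y. y j) \<in> borel_measurable param_measure" for j
  proof -
    have "(\<lambda>y. y j) \<in> param_measure \<rightarrow>\<^sub>M restrict_space lborel {-1/2..1/2}"
      unfolding param_measure_def by (rule measurable_component_singleton) simp
    then show ?thesis
      by (rule measurable_compose) (simp add: measurable_restrict_space1)
  qed
  then have "f \<in> borel_measurable param_measure"
    using borel_measurable_into_Params[OF f, of "\<lambda>y. y"] by (simp add: space_param_measure)
  ultimately show ?thesis
    by (intro integrable_const_bound[where B = B] AE_I2) (auto simp: space_param_measure)
qed

lemma E_y_diff:
  assumes "continuous_on Params f" "continuous_on Params g"
  shows "E_y (\<lambda>y. f y - g y) = E_y f - E_y g"
  using assms by (simp add: E_y_def integrable_param_measure)

section \<open>Variance of the estimator\<close>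

text \<open>A bias-variance decomposition: \<open>A\<close> is the deterministic bias, the
  \<open>X l\<close> are centred errors. After expansion the linear term vanishes by centring and
  the off-diagonal products vanish by assumption.\<close>

lemma (in prob_space) expectation_square_uncorrelated:
  fixes X :: "'i \<Rightarrow> 'a \<Rightarrow> real"
  assumes X: "\<And>l. l \<in> L \<Longrightarrow> integrable M (X l)" "\<And>l. l \<in> L \<Longrightarrow> expectation (X l) = 0"
    and XX: "\<And>l m. l \<in> L \<Longrightarrow> m \<in> L \<Longrightarrow> integrable M (\<lambda>\<omega>. X l \<omega> * X m \<omega>)"
      "\<And>l m. l \<in> L \<Longrightarrow> m \<in> L \<Longrightarrow> l \<noteq> m \<Longrightarrow> expectation (\<lambda>\<omega>. X l \<omega> * X m \<omega>) = 0"
  shows "expectation (\<lambda>\<omega>. (A + (\<Sum>l\<in>L. X l \<omega>))\<^sup>2) = A\<^sup>2 + (\<Sum>l\<in>L. expectation (\<lambda>\<omega>. (X l \<omega>)\<^sup>2))"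
\<comment> \<open>For infinite \<open>L\<close> both sums are 0 by convention and the two sides
  reduce to the square of \<open>A\<close>.\<close>
proof (cases "finite L")
  case True
  have "expectation (\<lambda>\<omega>. (A + (\<Sum>l\<in>L. X l \<omega>))\<^sup>2)
      = expectation (\<lambda>\<omega>. A\<^sup>2 + (\<Sum>l\<in>L. \<Sum>m\<in>L. X l \<omega> * X m \<omega>) + 2 * A * (\<Sum>l\<in>L. X l \<omega>))"
    by (simp add: power2_sum power2_eq_square[of "sum _ _"] sum_product)
  also have "\<dots> = A\<^sup>2 + (\<Sum>l\<in>L. \<Sum>m\<in>L. expectation (\<lambda>\<omega>. X l \<omega> * X m \<omega>))"
    using X XX(1) by (simp add: prob_space)
  also have "(\<Sum>l\<in>L. \<Sum>m\<in>L. expectation (\<lambda>\<omega>. X l \<omega> * X m \<omega>))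
      = (\<Sum>l\<in>L. \<Sum>m\<in>L. if m = l then expectation (\<lambda>\<omega>. (X l \<omega>)\<^sup>2) else 0)"
    using XX(2) by (intro sum.cong refl) (auto simp: power2_eq_square)
  finally show ?thesis
    using True by simp
qed (simp add: prob_space)

lemma integral_PiM_component:
  fixes f :: "'a \<Rightarrow> real"
  assumes M: "\<And>i. prob_space (M i)" and i: "i \<in> I" and f: "f \<in> borel_measurable (M i)"
  shows "(LINT x|PiM I M. f (x i)) = (LINT x|M i. f x)"
proof -
  have "(LINT x|M i. f x) = (LINT x|distr (PiM I M) (M i) (\<lambda>x. x i). f x)"
    using distr_PiM_component[of I M i] M i by simp
  also have "\<dots> = (LINT x|PiM I M. f (x i))"
    by (rule integral_distr) (use i f in auto)
  finally show ?thesis by simp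
qed

lemma integral_PiM_mult_components:
  fixes f g :: "'a \<Rightarrow> real"
  assumes M: "\<And>i. prob_space (M i)" and I: "finite I" "i \<in> I" "j \<in> I" "i \<noteq> j"
    and fg: "integrable (M i) f" "integrable (M j) g"
  shows "(LINT x|PiM I M. f (x i) * g (x j)) = (LINT x|M i. f x) * (LINT x|M j. g x)"
proof -
  interpret product_sigma_finite M
    using M by (simp add: product_sigma_finite_def prob_space_imp_sigma_finite)
  \<comment> \<open>Padding with the constant 1 turns the two factors into a product over all of
    \<open>I\<close>. The padded factors integrate to 1 because every \<open>M k\<close> is a
    probability measure.\<close>
  define F where "F k = (if k = i then f else if k = j then g else (\<lambda>_. 1))" for k
  have F: "integrable (M k) (F k)" for k
    using fg prob_space.finite_measure[OF M[of k]] by (auto simp: F_def finite_measure.integrable_const)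
  have split: "(\<Prod>k\<in>I. h k) = h i * h j" if "\<And>k. k \<noteq> i \<Longrightarrow> k \<noteq> j \<Longrightarrow> h k = 1" for h :: "'b \<Rightarrow> real"
  proof -
    have "prod h I = prod h {i, j}"
      by (rule prod.mono_neutral_right) (use I that in auto)
    with I show ?thesis by simp
  qed
  have "(LINT x|PiM I M. (\<Prod>k\<in>I. F k (x k))) = (\<Prod>k\<in>I. LINT x|M k. F k x)"
    by (rule product_integral_prod[OF I(1) F])
  moreover have "(\<Prod>k\<in>I. F k (x k)) = f (x i) * g (x j)" for x
    using I by (subst split) (auto simp: F_def)
  moreover have "(\<Prod>k\<in>I. LINT x|M k. F k x) = (LINT x|M i. f x) * (LINT x|M j. g x)"
    using I by (subst split) (auto simp: F_def prob_space.prob_space[OF M])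
  ultimately show ?thesis by simp
qed

section \<open>Randomly shifted lattice rules as random variables\<close>

text \<open>The fractional part absorbs any shift, inside the unit cube or not, and the padding
  value 0 is the midpoint of the interval. Bounds on lattice rules therefore hold for every shift,
  not merely almost surely.\<close>

lemma lattice_point_in_Params:
  "(\<lambda>j. if j < s then frac (real k * real (z j) / real N + \<Delta> j) - 1/2 else 0) \<in> Params"
  by (auto simp: Params_def less_imp_le[OF frac_lt_1])

abbreviation shift_cube :: "nat \<Rightarrow> (nat \<Rightarrow> real) measure" where
  "shift_cube s \<equiv> PiM {..<s} (\<lambda>_. restrict_space lborel {0..<1})"

lemma prob_space_shift_cube: "prob_space (shift_cube s)"
  by (intro prob_space_PiM prob_space_restrict_space) auto

lemma borel_measurable_lattice_rule:
  assumes f: "continuous_on Params f"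
  shows "(\<lambda>\<Delta>. lattice_rule s N z \<Delta> f) \<in> borel_measurable (shift_cube s)"
  unfolding lattice_rule_def
proof (intro borel_measurable_divide borel_measurable_sum borel_measurable_const
    borel_measurable_into_Params[OF f] lattice_point_in_Params)
  fix k j
  show "(\<lambda>\<Delta>. if j < s then frac (real k * real (z j) / real N + \<Delta> j) - 1/2 else 0)
      \<in> borel_measurable (shift_cube s)"
  proof (cases "j < s")
    case True
    have "(\<lambda>\<Delta>. \<Delta> j) \<in> shift_cube s \<rightarrow>\<^sub>M restrict_space lborel {0..<1}"
      using True by (intro measurable_component_singleton) simp
    then have "(\<lambda>\<Delta>. \<Delta> j) \<in> borel_measurable (shift_cube s)"
      by (rule measurable_compose) (simp add: measurable_restrict_space1)
    then have "(\<lambda>\<Delta>. real k * real (z j) / real N + \<Delta> j) \<in> borel_measurable (shift_cube s)"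
      by simp
    \<comment> \<open>Writing the fractional part through the floor function exposes it as a Borel
      function.\<close>
    from measurable_compose[OF this, of "\<lambda>t. t - real_of_int \<lfloor>t\<rfloor> - 1/2"] True show ?thesis
      by (simp add: frac_def)
  qed simp
qed

lemma lattice_rule_bounded:
  assumes f: "continuous_on Params f"
  shows "\<exists>B. \<forall>\<Delta>. \<bar>lattice_rule s N z \<Delta> f\<bar> \<le> B"
proof -
  obtain B where B: "\<And>y. y \<in> Params \<Longrightarrow> \<bar>f y\<bar> \<le> B"
    using continuous_on_Params_bounded[OF f] by blast
  \<comment> \<open>The quotient is left uncancelled, so that \<open>N = 0\<close>, where both sides
    are 0, needs no separate case.\<close>
  have "\<bar>lattice_rule s N z \<Delta> f\<bar> \<le> real N * B / real N" for \<Delta>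
    unfolding lattice_rule_def abs_divide abs_of_nat
    by (intro divide_right_mono order.trans[OF sum_abs] order.trans[OF sum_bounded_above[where K = B]]
        B lattice_point_in_Params) simp_all
  then show ?thesis by blast
qed

lemma integrable_lattice_rule:
  assumes f: "continuous_on Params f"
  shows "integrable (shift_cube s) (\<lambda>\<Delta>. lattice_rule s N z \<Delta> f)"
proof -
  interpret prob_space "shift_cube s" by (rule prob_space_shift_cube)
  obtain B where "\<And>\<Delta>. \<bar>lattice_rule s N z \<Delta> f\<bar> \<le> B"
    using lattice_rule_bounded[OF f] by blast
  then show ?thesis
    by (intro integrable_const_bound[where B = B] borel_measurable_lattice_rule f) auto
qed

lemma prob_space_shift_measure: "prob_space (shift_measure \<kappa>)"
  unfolding shift_measure_def using prob_space_shift_cube by (intro prob_space_PiM) auto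

lemma borel_measurable_shifted_lattice_rule:
  assumes f: "continuous_on Params f" and "l \<le> num_levels \<kappa>" "r \<in> {1..num_shifts \<kappa>}"
  shows "(\<lambda>\<Delta>. lattice_rule (trunc_dim \<kappa> l) N z (\<Delta> (l, r)) f) \<in> borel_measurable (shift_measure \<kappa>)"
proof (rule measurable_compose[OF _ borel_measurable_lattice_rule[OF f]])
  have "(\<lambda>\<Delta>. \<Delta> (l, r)) \<in> shift_measure \<kappa> \<rightarrow>\<^sub>M (case (l, r) of (l, r) \<Rightarrow> shift_cube (trunc_dim \<kappa> l))"
    unfolding shift_measure_def by (rule measurable_component_singleton) (use assms in auto)
  then show "(\<lambda>\<Delta>. \<Delta> (l, r)) \<in> shift_measure \<kappa> \<rightarrow>\<^sub>M shift_cube (trunc_dim \<kappa> l)" by simp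
qed

lemma integrable_shifted_lattice_rule:
  assumes f: "continuous_on Params f" and lr: "l \<le> num_levels \<kappa>" "r \<in> {1..num_shifts \<kappa>}"
  shows "integrable (shift_measure \<kappa>) (\<lambda>\<Delta>. lattice_rule (trunc_dim \<kappa> l) N z (\<Delta> (l, r)) f)"
proof -
  interpret prob_space "shift_measure \<kappa>" by (rule prob_space_shift_measure)
  obtain B where "\<And>\<Delta>. \<bar>lattice_rule (trunc_dim \<kappa> l) N z \<Delta> f\<bar> \<le> B"
    using lattice_rule_bounded[OF f] by blast
  then show ?thesis
    by (intro integrable_const_bound[where B = B] borel_measurable_shifted_lattice_rule assms) auto
qed

text \<open>The indices \<open>(l, r)\<close> and \<open>(m, t)\<close> may coincide, so squares are
  covered along with mixed products.\<close>

lemma integrable_shifted_lattice_rule_mult: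
  assumes f: "continuous_on Params f" and lr: "l \<le> num_levels \<kappa>" "r \<in> {1..num_shifts \<kappa>}"
    and g: "continuous_on Params g" and mt: "m \<le> num_levels \<kappa>" "t \<in> {1..num_shifts \<kappa>}"
  shows "integrable (shift_measure \<kappa>) (\<lambda>\<Delta>. lattice_rule (trunc_dim \<kappa> l) N z (\<Delta> (l, r)) f
    * lattice_rule (trunc_dim \<kappa> m) N' z' (\<Delta> (m, t)) g)"
proof -
  interpret prob_space "shift_measure \<kappa>" by (rule prob_space_shift_measure)
  obtain B where B: "\<And>\<Delta>. \<bar>lattice_rule (trunc_dim \<kappa> l) N z \<Delta> f\<bar> \<le> B"
    using lattice_rule_bounded[OF f] by blast
  obtain B' where B': "\<And>\<Delta>. \<bar>lattice_rule (trunc_dim \<kappa> m) N' z' \<Delta> g\<bar> \<le> B'"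
    using lattice_rule_bounded[OF g] by blast
  \<comment> \<open>Any one shift shows that the bound is nonnegative, as multiplying the two bounds
    requires.\<close>
  have "0 \<le> B" using B[of undefined] by linarith
  then show ?thesis
    by (intro integrable_const_bound[where B = "B * B'"] borel_measurable_times
        borel_measurable_shifted_lattice_rule assms AE_I2)
      (auto simp: abs_mult intro!: mult_mono B B')
qed

text \<open>Different levels give different indices \<open>(l, r)\<close> and \<open>(m, t)\<close>
  whatever the shift numbers are, so the two rules read distinct coordinates of a product measure.
  The marginal integrals are then lifted back to \<open>shift_measure\<close>.\<close>

lemma integral_shifted_lattice_rule_mult:
  assumes f: "continuous_on Params f" and lr: "l \<le> num_levels \<kappa>" "r \<in> {1..num_shifts \<kappa>}"
    and g: "continuous_on Params g" and mt: "m \<le> num_levels \<kappa>" "t \<in> {1..num_shifts \<kappa>}"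
    and ne: "l \<noteq> m"
  shows "(LINT \<Delta>|shift_measure \<kappa>. lattice_rule (trunc_dim \<kappa> l) N z (\<Delta> (l, r)) f
      * lattice_rule (trunc_dim \<kappa> m) N' z' (\<Delta> (m, t)) g)
    = (LINT \<Delta>|shift_measure \<kappa>. lattice_rule (trunc_dim \<kappa> l) N z (\<Delta> (l, r)) f)
      * (LINT \<Delta>|shift_measure \<kappa>. lattice_rule (trunc_dim \<kappa> m) N' z' (\<Delta> (m, t)) g)"
proof -
  let ?M = "\<lambda>(l, r::nat). shift_cube (trunc_dim \<kappa> l)"
  let ?I = "{..num_levels \<kappa>} \<times> {1..num_shifts \<kappa>}"
  have M: "prob_space (?M i)" for i
    using prob_space_shift_cube by (cases i) simp
  show ?thesis
    unfolding shift_measure_def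
    using integral_PiM_mult_components[of ?M ?I "(l, r)" "(m, t)"
        "\<lambda>\<Delta>. lattice_rule (trunc_dim \<kappa> l) N z \<Delta> f" "\<lambda>\<Delta>. lattice_rule (trunc_dim \<kappa> m) N' z' \<Delta> g", OF M]
      integral_PiM_component[of ?M "(l, r)" ?I "\<lambda>\<Delta>. lattice_rule (trunc_dim \<kappa> l) N z \<Delta> f", OF M]
      integral_PiM_component[of ?M "(m, t)" ?I "\<lambda>\<Delta>. lattice_rule (trunc_dim \<kappa> m) N' z' \<Delta> g", OF M]
      integrable_lattice_rule[OF f] integrable_lattice_rule[OF g]
      borel_measurable_lattice_rule[OF f] borel_measurable_lattice_rule[OF g] assms
    by simp
qed

section \<open>Second moments of the level estimators\<close>

lemma integrable_Q_level:
  assumes "continuous_on Params f" "l \<le> num_levels \<kappa>"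
  shows "integrable (shift_measure \<kappa>) (Q_level \<kappa> l f)"
  unfolding Q_level_def
  by (intro integrable_divide_zero impI Bochner_Integration.integrable_sum
      integrable_shifted_lattice_rule assms)

text \<open>Expanding over pairs of shifts reduces the product to terms with one lattice rule per
  level, to which the factorisation applies.\<close>

lemma Q_level_mult:
  "Q_level \<kappa> l f \<Delta> * Q_level \<kappa> m g \<Delta> =
    (\<Sum>r=1..num_shifts \<kappa>. \<Sum>t=1..num_shifts \<kappa>.
      lattice_rule (trunc_dim \<kappa> l) (num_points \<kappa> l) (gen_vec \<kappa> l) (\<Delta> (l, r)) f
      * lattice_rule (trunc_dim \<kappa> m) (num_points \<kappa> m) (gen_vec \<kappa> m) (\<Delta> (m, t)) g)
      / (real (num_shifts \<kappa>) * real (num_shifts \<kappa>))"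
  unfolding Q_level_def times_divide_times_eq sum_product ..

lemma integrable_Q_level_mult:
  assumes "continuous_on Params f" "l \<le> num_levels \<kappa>" "continuous_on Params g" "m \<le> num_levels \<kappa>"
  shows "integrable (shift_measure \<kappa>) (\<lambda>\<Delta>. Q_level \<kappa> l f \<Delta> * Q_level \<kappa> m g \<Delta>)"
  unfolding Q_level_mult
  by (intro integrable_divide_zero impI Bochner_Integration.integrable_sum
      integrable_shifted_lattice_rule_mult assms)

lemma E_shift_Q_level_mult:
  assumes "continuous_on Params f" "l \<le> num_levels \<kappa>" "continuous_on Params g" "m \<le> num_levels \<kappa>"
    and "l \<noteq> m"
  shows "E_shift \<kappa> (\<lambda>\<Delta>. Q_level \<kappa> l f \<Delta> * Q_level \<kappa> m g \<Delta>)
    = E_shift \<kappa> (Q_level \<kappa> l f) * E_shift \<kappa> (Q_level \<kappa> m g)"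
proof -
  let ?f = "\<lambda>r \<Delta>. lattice_rule (trunc_dim \<kappa> l) (num_points \<kappa> l) (gen_vec \<kappa> l) (\<Delta> (l, r)) f"
  let ?g = "\<lambda>r \<Delta>. lattice_rule (trunc_dim \<kappa> m) (num_points \<kappa> m) (gen_vec \<kappa> m) (\<Delta> (m, r)) g"
  let ?R = "{1..num_shifts \<kappa>}"
  have i: "integrable (shift_measure \<kappa>) (?f r)" "integrable (shift_measure \<kappa>) (?g r)"
    if "r \<in> ?R" for r
    using that assms by (auto intro!: integrable_shifted_lattice_rule)
  have ii: "integrable (shift_measure \<kappa>) (\<lambda>\<Delta>. ?f r \<Delta> * ?g t \<Delta>)" if "r \<in> ?R" "t \<in> ?R" for r t
    by (intro integrable_shifted_lattice_rule_mult assms that)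
  have e: "E_shift \<kappa> (\<lambda>\<Delta>. ?f r \<Delta> * ?g t \<Delta>) = E_shift \<kappa> (?f r) * E_shift \<kappa> (?g t)"
    if "r \<in> ?R" "t \<in> ?R" for r t
    unfolding E_shift_def by (intro integral_shifted_lattice_rule_mult assms that)
  have "E_shift \<kappa> (\<lambda>\<Delta>. \<Sum>r\<in>?R. \<Sum>t\<in>?R. ?f r \<Delta> * ?g t \<Delta>)
      = (\<Sum>r\<in>?R. \<Sum>t\<in>?R. E_shift \<kappa> (\<lambda>\<Delta>. ?f r \<Delta> * ?g t \<Delta>))"
    unfolding E_shift_def
    by (subst Bochner_Integration.integral_sum;
        (intro Bochner_Integration.integrable_sum sum.cong refl Bochner_Integration.integral_sum ii)?)
  also have "\<dots> = (\<Sum>r\<in>?R. E_shift \<kappa> (?f r)) * (\<Sum>t\<in>?R. E_shift \<kappa> (?g t))"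
    unfolding sum_product by (intro sum.cong refl e)
  also have "\<dots> = E_shift \<kappa> (\<lambda>\<Delta>. \<Sum>r\<in>?R. ?f r \<Delta>) * E_shift \<kappa> (\<lambda>\<Delta>. \<Sum>t\<in>?R. ?g t \<Delta>)"
    unfolding E_shift_def by (intro arg_cong2[of _ _ _ _ "(*)"] Bochner_Integration.integral_sum[symmetric] i)
  finally show ?thesis
    \<comment> \<open>The product has to be rewritten while \<open>Q_level\<close> is still folded,
      hence the two stages.\<close>
    unfolding E_shift_def Q_level_mult unfolding Q_level_def integral_divide_zero
    by simp
qed

lemma E_shift_square_error:
  assumes f: "\<And>l. l \<le> num_levels \<kappa> \<Longrightarrow> continuous_on Params (f l)"
    and unbiased: "\<And>l. l \<le> num_levels \<kappa> \<Longrightarrow> E_shift \<kappa> (Q_level \<kappa> l (f l)) = E_y (f l)"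
  shows "E_shift \<kappa> (\<lambda>\<Delta>. (c - (\<Sum>l\<le>num_levels \<kappa>. Q_level \<kappa> l (f l) \<Delta>))\<^sup>2)
    = (c - (\<Sum>l\<le>num_levels \<kappa>. E_y (f l)))\<^sup>2 + (\<Sum>l\<le>num_levels \<kappa>. V_shift \<kappa> l (f l))"
proof -
  interpret prob_space "shift_measure \<kappa>" by (rule prob_space_shift_measure)
  let ?L = "{..num_levels \<kappa>}"
  let ?X = "\<lambda>l \<Delta>. E_y (f l) - Q_level \<kappa> l (f l) \<Delta>"
  have i: "integrable (shift_measure \<kappa>) (Q_level \<kappa> l (f l))" if "l \<in> ?L" for l
    using that f by (simp add: integrable_Q_level)
  have ii: "integrable (shift_measure \<kappa>) (\<lambda>\<Delta>. Q_level \<kappa> l (f l) \<Delta> * Q_level \<kappa> m (f m) \<Delta>)"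
    if "l \<in> ?L" "m \<in> ?L" for l m
    using that f by (simp add: integrable_Q_level_mult)
  \<comment> \<open>Expanding the centred product leaves only constants, single estimators and one
    product of estimators, all with known expectations.\<close>
  have X: "?X l \<Delta> * ?X m \<Delta> = E_y (f l) * E_y (f m) - E_y (f l) * Q_level \<kappa> m (f m) \<Delta>
      - E_y (f m) * Q_level \<kappa> l (f l) \<Delta> + Q_level \<kappa> l (f l) \<Delta> * Q_level \<kappa> m (f m) \<Delta>" for l m \<Delta>
    by (simp add: algebra_simps)
  \<comment> \<open>Adding and subtracting the exact expectations of the levels isolates the
    constant bias from the centred errors.\<close>
  have "expectation (\<lambda>\<Delta>. ((c - (\<Sum>l\<in>?L. E_y (f l))) + (\<Sum>l\<in>?L. ?X l \<Delta>))\<^sup>2)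
    = (c - (\<Sum>l\<in>?L. E_y (f l)))\<^sup>2 + (\<Sum>l\<in>?L. expectation (\<lambda>\<Delta>. (?X l \<Delta>)\<^sup>2))"
  proof (rule expectation_square_uncorrelated)
    fix l m assume l: "l \<in> ?L" and m: "m \<in> ?L"
    show "integrable (shift_measure \<kappa>) (?X l)"
      using i[OF l] by simp
    show "expectation (?X l) = 0"
      using i[OF l] l unbiased by (simp add: prob_space E_shift_def)
    show "integrable (shift_measure \<kappa>) (\<lambda>\<Delta>. ?X l \<Delta> * ?X m \<Delta>)"
      unfolding X using i[OF l] i[OF m] ii[OF l m] by simp
    show "expectation (\<lambda>\<Delta>. ?X l \<Delta> * ?X m \<Delta>) = 0" if "l \<noteq> m"
    proof -
      have "E_shift \<kappa> (\<lambda>\<Delta>. Q_level \<kappa> l (f l) \<Delta> * Q_level \<kappa> m (f m) \<Delta>) = E_y (f l) * E_y (f m)"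
        using E_shift_Q_level_mult[of "f l" l \<kappa> "f m" m] f unbiased l m that by simp
      then show ?thesis
        unfolding X using i[OF l] i[OF m] ii[OF l m] l m unbiased
        by (simp add: prob_space E_shift_def)
    qed
  qed
  then show ?thesis
    by (simp add: E_shift_def V_shift_def sum_subtractf)
qed

section \<open>The mean square error bound\<close>

lemma square_sum_le: "((x::real) + y)\<^sup>2 \<le> 2 * (x\<^sup>2 + y\<^sup>2)"
  using sum_squares_bound[of x y] by (simp add: power2_sum)

lemma powr_square: "(x powr a)\<^sup>2 = x powr (2 * a)" for x a :: real
  by (simp add: power2_eq_square flip: powr_add)

theorem theorem3p2:
  fixes D :: "(real ^ 'd) set"
    and a b :: "nat \<Rightarrow> real ^ 'd \<Rightarrow> real"
    and c :: "real ^ 'd \<Rightarrow> real"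
    and amin amax p q :: real
    and lam :: "(nat \<Rightarrow> real) \<Rightarrow> real"
    and u :: "(nat \<Rightarrow> real) \<Rightarrow> real ^ 'd \<Rightarrow> real"
    and H :: "real set"
    and Vh :: "real \<Rightarrow> (real ^ 'd \<Rightarrow> real) set"
    and lamh :: "real \<Rightarrow> nat \<Rightarrow> (nat \<Rightarrow> real) \<Rightarrow> real"
    and uh :: "real \<Rightarrow> nat \<Rightarrow> (nat \<Rightarrow> real) \<Rightarrow> real ^ 'd \<Rightarrow> real"
    and G :: "(real ^ 'd \<Rightarrow> real) \<Rightarrow> real"
    and Conf :: "mlqmc_config set"
    and \<alpha> \<alpha>' \<beta> \<beta>' \<eta> :: real
  assumes dim: "CARD('d) \<in> {1, 2, 3}"
    and domain: "open D" "D \<noteq> {}" "bounded D" "convex D"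
    \<comment> \<open>coefficients\<close>
    and a_Linf: "\<And>j. in_W1inf D (a j)"
    and b_Linf: "\<And>j. in_Linf D (b j)"
    and c_Linf: "in_Linf D c"
    and amin: "0 < amin"
    and a_lower: "\<And>y. y \<in> Params \<Longrightarrow> AE x in lebesgue_on D. amin \<le> affine_coeff a y x"
    and b_lower: "\<And>y. y \<in> Params \<Longrightarrow> AE x in lebesgue_on D. 0 \<le> affine_coeff b y x"
    and c_lower: "AE x in lebesgue_on D. amin \<le> c x"
    and pq: "0 < p" "p < 1" "0 < q" "q < 1"
    and ab_summable:
      "summable (\<lambda>j. (max (Linf_norm D (a (Suc j))) (Linf_norm D (b (Suc j)))) powr p)"
    and grad_summable: "summable (\<lambda>j. (Linf_norm D (weak_grad D (a (Suc j)))) powr q)"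
    and a_upper: "\<And>y. y \<in> Params \<Longrightarrow> in_W1inf D (affine_coeff a y) \<and>
        Linf_norm D (affine_coeff a y) \<le> amax \<and>
        Linf_norm D (weak_grad D (affine_coeff a y)) \<le> amax"
    and b_upper: "\<And>y. y \<in> Params \<Longrightarrow> in_Linf D (affine_coeff b y) \<and>
        Linf_norm D (affine_coeff b y) \<le> amax"
    and c_upper: "Linf_norm D c \<le> amax"
    \<comment> \<open>exact and finite element eigenpairs\<close>
    and exact: "\<And>y. y \<in> Params \<Longrightarrow>
        smallest_eigenpair D (H10 D) (affine_coeff a y) (affine_coeff b y) c (lam y) (u y)"
    and fe_spaces: "\<And>h. h \<in> H \<Longrightarrow> fe_space D h (Vh h)"
    and fe: "\<And>h s y. h \<in> H \<Longrightarrow> 1 \<le> s \<Longrightarrow> y \<in> Params \<Longrightarrow>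
        smallest_eigenpair D (Vh h) (affine_coeff a (trunc_param s y)) (affine_coeff b (trunc_param s y)) c
          (lamh h s y) (uh h s y)"
    and fe_trunc: "\<And>h s y. h \<in> H \<Longrightarrow> 1 \<le> s \<Longrightarrow> y \<in> Params \<Longrightarrow>
        uh h s (trunc_param s y) = uh h s y"
    \<comment> \<open>choice of the signs of the eigenfunctions\<close>
    and exact_smooth: "smooth_in_param D u"
    and fe_smooth: "\<And>h s. h \<in> H \<Longrightarrow> 1 \<le> s \<Longrightarrow> smooth_in_param D (uh h s)"
    and fe_approx: "\<And>s y. 1 \<le> s \<Longrightarrow> y \<in> Params \<Longrightarrow>
        ((\<lambda>h. H1_norm D (\<lambda>x. u (trunc_param s y) x - uh h s y x)) \<longlongrightarrow> 0) (at 0 within H)"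
    \<comment> \<open>the functional and the configurations over which the estimates are uniform\<close>
    and G: "G \<in> dual_H10 D"
    and Conf: "\<And>\<kappa>. \<kappa> \<in> Conf \<Longrightarrow> admissible H \<kappa>"
    and unbiased: "\<And>\<kappa> l. \<kappa> \<in> Conf \<Longrightarrow> l \<le> num_levels \<kappa> \<Longrightarrow>
        E_shift \<kappa> (Q_level \<kappa> l (\<lambda>y. G (level_diff uh \<kappa> l y))) = E_y (\<lambda>y. G (level_diff uh \<kappa> l y))"
    and pos: "0 < \<alpha>" "0 < \<alpha>'" "0 < \<beta>" "0 < \<beta>'" "0 < \<eta>"
    and M1: "lesssim Conf
        (\<lambda>\<kappa>. \<bar>E_y (\<lambda>y. G (\<lambda>x. u y x - level_fun uh \<kappa> (num_levels \<kappa>) y x))\<bar>)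
        (\<lambda>\<kappa>. meshwidth \<kappa> (num_levels \<kappa>) powr \<alpha>
            + real (trunc_dim \<kappa> (num_levels \<kappa>)) powr (- \<alpha>'))"
    and M2: "lesssim {(\<kappa>, l). \<kappa> \<in> Conf \<and> l \<le> num_levels \<kappa>}
        (\<lambda>(\<kappa>, l). V_shift \<kappa> l (\<lambda>y. G (level_diff uh \<kappa> l y)))
        (\<lambda>(\<kappa>, l). 1 / real (num_shifts \<kappa>) * real (num_points \<kappa> l) powr (- \<eta>)
            * (prev_meshwidth \<kappa> l powr \<beta> + real (prev_trunc_dim \<kappa> l) powr (- \<beta>')))"
  shows "lesssim Conf
        (\<lambda>\<kappa>. E_shift \<kappa> (\<lambda>\<Delta>. \<bar>E_y (\<lambda>y. G (u y)) - Q_ML G uh \<kappa> \<Delta>\<bar>\<^sup>2))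
        (\<lambda>\<kappa>. meshwidth \<kappa> (num_levels \<kappa>) powr (2 * \<alpha>)
            + real (trunc_dim \<kappa> (num_levels \<kappa>)) powr (- 2 * \<alpha>')
            + 1 / real (num_shifts \<kappa>) * (\<Sum>l\<le>num_levels \<kappa>. 1 / real (num_points \<kappa> l) powr \<eta>
                * (prev_meshwidth \<kappa> l powr \<beta> + real (prev_trunc_dim \<kappa> l) powr (- \<beta>'))))"
proof -
  have D: "D \<in> sets lebesgue"
    using domain(1) by simp
  define F where "F \<kappa> l y = G (level_fun uh \<kappa> l y)" for \<kappa> l y
  have smooth: "smooth_in_param D (level_fun uh \<kappa> l)" if "\<kappa> \<in> Conf" "l \<le> num_levels \<kappa>" for \<kappa> l
    using Conf[OF that(1)] that(2) fe_smooth unfolding level_fun_def admissible_def by blast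
  have F: "continuous_on Params (F \<kappa> l)" if "\<kappa> \<in> Conf" "l \<le> num_levels \<kappa>" for \<kappa> l
    unfolding F_def by (rule continuous_on_functional[OF D G smooth[OF that]])
  have Gu: "continuous_on Params (\<lambda>y. G (u y))"
    by (rule continuous_on_functional[OF D G exact_smooth])
  \<comment> \<open>Level 0 subtracts the constant 0, so the two functions coincide and linearity of
    \<open>G\<close> is not invoked.\<close>
  have diff_0: "G (level_diff uh \<kappa> 0 y) = F \<kappa> 0 y" for \<kappa> y
  proof -
    have "level_diff uh \<kappa> 0 y = level_fun uh \<kappa> 0 y"
      by (simp add: level_diff_def fun_eq_iff)
    then show ?thesis by (simp add: F_def)
  qed
  \<comment> \<open>Linearity of \<open>G\<close> needs both eigenfunctions in \<open>H10 D\<close>,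
    which smoothness yields for \<open>y\<close> in \<open>Params\<close>. The identity is therefore
    used only there, which is enough for continuity on \<open>Params\<close> and for integrals over
    the parameter space.\<close>
  have diff_Suc: "G (level_diff uh \<kappa> (Suc k) y) = F \<kappa> (Suc k) y - F \<kappa> k y"
    if "\<kappa> \<in> Conf" "Suc k \<le> num_levels \<kappa>" "y \<in> Params" for \<kappa> k y
  proof -
    have "level_diff uh \<kappa> (Suc k) y
        = (\<lambda>x. level_fun uh \<kappa> (Suc k) y x - level_fun uh \<kappa> k y x)"
      by (simp add: level_diff_def fun_eq_iff)
    then show ?thesis
      using that smooth by (simp add: F_def smooth_in_param_H10 dual_H10_diff[OF G])
  qed
  have cont: "continuous_on Params (\<lambda>y. G (level_diff uh \<kappa> l y))"
    if "\<kappa> \<in> Conf" "l \<le> num_levels \<kappa>" for \<kappa> l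
  proof (cases l)
    case 0
    with F that show ?thesis by (simp add: diff_0)
  next
    case (Suc k)
    have "continuous_on Params (\<lambda>y. F \<kappa> (Suc k) y - F \<kappa> k y)"
      using F that Suc by (intro continuous_on_diff) simp_all
    then show ?thesis
      by (rule continuous_on_eq) (use diff_Suc that Suc in simp)
  qed
  \<comment> \<open>Stated for every \<open>n\<close> up to the finest level to allow induction; the
    boundary term at the coarse end is absent because level 0 contributes
    \<open>F \<kappa> 0\<close> in full.\<close>
  have telescope: "(\<Sum>l\<le>n. E_y (\<lambda>y. G (level_diff uh \<kappa> l y))) = E_y (F \<kappa> n)"
    if \<kappa>: "\<kappa> \<in> Conf" and n: "n \<le> num_levels \<kappa>" for \<kappa> n
    using n
  proof (induction n)
    case 0
    show ?case by (simp add: diff_0)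
  next
    case (Suc k)
    have "E_y (\<lambda>y. G (level_diff uh \<kappa> (Suc k) y)) = E_y (\<lambda>y. F \<kappa> (Suc k) y - F \<kappa> k y)"
      unfolding E_y_def
      by (intro Bochner_Integration.integral_cong) (use diff_Suc \<kappa> Suc.prems in \<open>simp_all add: space_param_measure\<close>)
    then show ?case
      using Suc F[OF \<kappa>] by (simp add: E_y_diff)
  qed
  have bias: "E_y (\<lambda>y. G (\<lambda>x. u y x - level_fun uh \<kappa> (num_levels \<kappa>) y x))
      = E_y (\<lambda>y. G (u y)) - E_y (F \<kappa> (num_levels \<kappa>))" if \<kappa>: "\<kappa> \<in> Conf" for \<kappa>
  proof -
    have "E_y (\<lambda>y. G (\<lambda>x. u y x - level_fun uh \<kappa> (num_levels \<kappa>) y x))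
        = E_y (\<lambda>y. G (u y) - F \<kappa> (num_levels \<kappa>) y)"
      unfolding E_y_def F_def
      by (intro Bochner_Integration.integral_cong refl dual_H10_diff[OF G]
          smooth_in_param_H10[OF exact_smooth] smooth_in_param_H10[OF smooth[OF \<kappa> order.refl]])
        (simp_all add: space_param_measure)
    also have "\<dots> = E_y (\<lambda>y. G (u y)) - E_y (F \<kappa> (num_levels \<kappa>))"
      by (rule E_y_diff[OF Gu F[OF \<kappa> order.refl]])
    finally show ?thesis .
  qed
  obtain C1 where C1: "C1 > 0" and M1': "\<And>\<kappa>. \<kappa> \<in> Conf \<Longrightarrow>
      \<bar>E_y (\<lambda>y. G (u y)) - E_y (F \<kappa> (num_levels \<kappa>))\<bar>
      \<le> C1 * (meshwidth \<kappa> (num_levels \<kappa>) powr \<alpha> + real (trunc_dim \<kappa> (num_levels \<kappa>)) powr (- \<alpha>'))"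
    using M1 bias unfolding lesssim_def by auto
  \<comment> \<open>The contribution of one level without the common factor
    \<open>1 / num_shifts\<close>, written as in the conclusion; M2 has a negative exponent instead
    of the quotient.\<close>
  define v where "v \<kappa> l = 1 / real (num_points \<kappa> l) powr \<eta>
      * (prev_meshwidth \<kappa> l powr \<beta> + real (prev_trunc_dim \<kappa> l) powr (- \<beta>'))" for \<kappa> l
  obtain C2 where C2: "C2 > 0" and M2': "\<And>\<kappa> l. \<kappa> \<in> Conf \<Longrightarrow> l \<le> num_levels \<kappa> \<Longrightarrow>
      V_shift \<kappa> l (\<lambda>y. G (level_diff uh \<kappa> l y)) \<le> C2 * (1 / real (num_shifts \<kappa>) * v \<kappa> l)"
    using M2 unfolding lesssim_def v_def by (auto simp: powr_minus_divide mult.assoc)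
  \<comment> \<open>The first entry arises from squaring M1 and bounding the square of its two-term
    sum; the second is the constant of M2. Their maximum serves both parts, whose right-hand sides
    are nonnegative.\<close>
  define C where "C = max (2 * C1\<^sup>2) C2"
  show ?thesis
    unfolding lesssim_def v_def[symmetric]
  proof (intro exI[of _ C] conjI ballI)
    show "0 < C" using C2 by (simp add: C_def)
    fix \<kappa> assume \<kappa>: "\<kappa> \<in> Conf"
    define h where "h = meshwidth \<kappa> (num_levels \<kappa>)"
    define s where "s = real (trunc_dim \<kappa> (num_levels \<kappa>))"
    define V where "V = 1 / real (num_shifts \<kappa>) * (\<Sum>l\<le>num_levels \<kappa>. v \<kappa> l)"
    have V: "0 \<le> V"
      unfolding V_def v_def by (intro mult_nonneg_nonneg sum_nonneg add_nonneg_nonneg) simp_all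
    \<comment> \<open>Here \<open>c\<close> of the error decomposition is the exact expectation
      \<open>E_y (\<lambda>y. G (u y))\<close>, and telescoping collapses the subtracted sum to the
      finest level.\<close>
    have "E_shift \<kappa> (\<lambda>\<Delta>. \<bar>E_y (\<lambda>y. G (u y)) - Q_ML G uh \<kappa> \<Delta>\<bar>\<^sup>2)
        = (E_y (\<lambda>y. G (u y)) - E_y (F \<kappa> (num_levels \<kappa>)))\<^sup>2
          + (\<Sum>l\<le>num_levels \<kappa>. V_shift \<kappa> l (\<lambda>y. G (level_diff uh \<kappa> l y)))"
      using E_shift_square_error[of \<kappa> "\<lambda>l y. G (level_diff uh \<kappa> l y)"] cont unbiased telescope \<kappa>
      by (simp add: Q_ML_def)
    also have "(E_y (\<lambda>y. G (u y)) - E_y (F \<kappa> (num_levels \<kappa>)))\<^sup>2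
        \<le> C * (h powr (2 * \<alpha>) + s powr (- 2 * \<alpha>'))"
    proof -
      have "(E_y (\<lambda>y. G (u y)) - E_y (F \<kappa> (num_levels \<kappa>)))\<^sup>2
          \<le> (C1 * (h powr \<alpha> + s powr (- \<alpha>')))\<^sup>2"
        using power_mono[OF M1'[OF \<kappa>], of 2] by (simp add: h_def s_def)
      also have "\<dots> = C1\<^sup>2 * (h powr \<alpha> + s powr (- \<alpha>'))\<^sup>2"
        by (rule power_mult_distrib)
      also have "\<dots> \<le> C1\<^sup>2 * (2 * ((h powr \<alpha>)\<^sup>2 + (s powr (- \<alpha>'))\<^sup>2))"
        by (intro mult_left_mono square_sum_le) simp
      also have "\<dots> = 2 * C1\<^sup>2 * (h powr (2 * \<alpha>) + s powr (- 2 * \<alpha>'))"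
        by (simp add: powr_square)
      also have "\<dots> \<le> C * (h powr (2 * \<alpha>) + s powr (- 2 * \<alpha>'))"
        unfolding C_def by (intro mult_right_mono) simp_all
      finally show ?thesis .
    qed
    also have "(\<Sum>l\<le>num_levels \<kappa>. V_shift \<kappa> l (\<lambda>y. G (level_diff uh \<kappa> l y))) \<le> C * V"
    proof -
      have "(\<Sum>l\<le>num_levels \<kappa>. V_shift \<kappa> l (\<lambda>y. G (level_diff uh \<kappa> l y)))
          \<le> (\<Sum>l\<le>num_levels \<kappa>. C2 * (1 / real (num_shifts \<kappa>) * v \<kappa> l))"
        by (intro sum_mono M2' \<kappa>) simp
      also have "\<dots> = C2 * V"
        unfolding V_def by (simp only: sum_distrib_left)
      also have "\<dots> \<le> C * V"
        unfolding C_def using V by (intro mult_right_mono) simp_all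
      finally show ?thesis .
    qed
    finally show "E_shift \<kappa> (\<lambda>\<Delta>. \<bar>E_y (\<lambda>y. G (u y)) - Q_ML G uh \<kappa> \<Delta>\<bar>\<^sup>2)
        \<le> C * (meshwidth \<kappa> (num_levels \<kappa>) powr (2 * \<alpha>)
          + real (trunc_dim \<kappa> (num_levels \<kappa>)) powr (- 2 * \<alpha>')
          + 1 / real (num_shifts \<kappa>) * (\<Sum>l\<le>num_levels \<kappa>. v \<kappa> l))"
      by (simp add: h_def s_def V_def distrib_left)
  qed
qed

end
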